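(* Let $A = {}^{1}A\,e_1+{}^{2}A\,e_2 = [\xi_{ij}]_{m\times n}\in\mathbb{C}_2^{m\times n}$ and $B = {}^{1}B\,e_1+{}^{2}B\,e_2=(b_1,\dots,b_m)\in\mathbb{C}_2^m$, and let $AX=B$ be a system of $m$ equations in $n$ variables $x_1,\dots,x_n\in\mathbb{C}_2$, where $X=(x_1,\dots,x_n)\in\mathbb{C}_2^n$. Then the following conditions are equivalent: (1) There exists a solution $X \in \mathbb{C}_2^n$ of the system of equations $AX=B$. (2) $\rho({}^{1}A\mid{}^{1}B)=\rho({}^{1}A)$ and $\rho({}^{2}A\mid{}^{2}B)=\rho({}^{2}A)$. (3) $\rho_{mr}(A\mid B)=\rho_{mr}(A)$.
   Context: $\mathbb{C}_1$ denotes the field of complex numbers (with imaginary unit $i_1$). The bicomplex numbers are the commutative ring $\mathbb{C}_2 = \{z_1 + i_2 z_2 : z_1, z_2\in\mathbb{C}_1\}$ with $i_1^2=i_2^2=-1$, $i_1i_2=i_2i_1$. Put $e_1 = (1+i_1i_2)/2$, $e_2 = (1-i_1i_2)/2$; these are idempotents with $e_1e_2=0$, $e_1+e_2=1$. Every $\xi = z_1+i_2z_2\in\mathbb{C}_2$ is uniquely $\xi = {}^{1}\xi\, e_1 + {}^{2}\xi\, e_2$ with ${}^{1}\xi = z_1 - i_1z_2$, ${}^{2}\xi = z_1+i_1z_2$ in $\mathbb{C}_1$. Applied entrywise, every bicomplex matrix $M$ is uniquely ${}^{1}M\,e_1+{}^{2}M\,e_2$ with ${}^{1}M,{}^{2}M$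 complex matrices of the same size, and every $B\in\mathbb{C}_2^m$ is uniquely ${}^{1}B\,e_1+{}^{2}B\,e_2$ with ${}^{1}B,{}^{2}B\in\mathbb{C}_1^m$. $\rho$ of a complex matrix is its usual rank; the modified rank of a bicomplex matrix $M$ is $\rho_{mr}(M)=\rho({}^{1}M)+\rho({}^{2}M)$; and $(M\mid v)$ denotes the matrix $M$ augmented by the column $v$. Vectors are treated as columns in products such as $AX$. *)

theory Defs
  imports Complex_Main "Jordan_Normal_Form.DL_Rank"
begin

section \<open>Bicomplex numbers\<close>

text \<open>\<open>Bicomplex z1 z2\<close> stands for \<open>z1 + i\<^sub>2 z2\<close>; the unit \<open>i\<^sub>1\<close> is the imaginary unit of the
  complex coefficients.\<close>

datatype bicomplex = Bicomplex (bc_fst: complex) (bc_snd: complex)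

instantiation bicomplex :: comm_ring_1
begin

definition "0 = Bicomplex 0 0"
definition "1 = Bicomplex 1 0"
definition "x + y = Bicomplex (bc_fst x + bc_fst y) (bc_snd x + bc_snd y)"
definition "x - y = Bicomplex (bc_fst x - bc_fst y) (bc_snd x - bc_snd y)"
definition "- x = Bicomplex (- bc_fst x) (- bc_snd x)"
definition "x * y = Bicomplex (bc_fst x * bc_fst y - bc_snd x * bc_snd y)
                              (bc_fst x * bc_snd y + bc_snd x * bc_fst y)"

lemmas bicomplex_ops_def =
  zero_bicomplex_def one_bicomplex_def plus_bicomplex_def minus_bicomplex_def
  uminus_bicomplex_def times_bicomplex_def

instance
  by standard (auto simp: bicomplex_ops_def algebra_simps)

end

definition bc_of_complex :: "complex \<Rightarrow> bicomplex" where
  "bc_of_complex z = Bicomplex z 0"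

definition bc_i1 :: bicomplex where "bc_i1 = bc_of_complex \<i>"
definition bc_i2 :: bicomplex where "bc_i2 = Bicomplex 0 1"

lemma bc_i1_i2:
  "bc_i1 * bc_i1 = - 1" "bc_i2 * bc_i2 = - 1" "bc_i1 * bc_i2 = bc_i2 * bc_i1"
  by (auto simp: bc_i1_def bc_i2_def bc_of_complex_def bicomplex_ops_def)

lemma Bicomplex_eq: "Bicomplex z1 z2 = bc_of_complex z1 + bc_i2 * bc_of_complex z2"
  by (auto simp: bc_i2_def bc_of_complex_def bicomplex_ops_def)


section \<open>Idempotent components\<close>

definition bc_e1 :: bicomplex where
  "bc_e1 = bc_of_complex (1 / 2) * (1 + bc_i1 * bc_i2)"

definition bc_e2 :: bicomplex where
  "bc_e2 = bc_of_complex (1 / 2) * (1 - bc_i1 * bc_i2)"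

definition bc_comp1 :: "bicomplex \<Rightarrow> complex" where
  "bc_comp1 x = bc_fst x - \<i> * bc_snd x"

definition bc_comp2 :: "bicomplex \<Rightarrow> complex" where
  "bc_comp2 x = bc_fst x + \<i> * bc_snd x"

lemmas bc_idem_defs = bc_e1_def bc_e2_def bc_comp1_def bc_comp2_def
  bc_i1_def bc_i2_def bc_of_complex_def

lemma bc_e_idempotent:
  "bc_e1 * bc_e1 = bc_e1" "bc_e2 * bc_e2 = bc_e2" "bc_e1 * bc_e2 = 0" "bc_e1 + bc_e2 = 1"
  by (auto simp: bc_idem_defs bicomplex_ops_def)

lemma bc_idempotent_decomp_iff:
  "x = bc_of_complex a * bc_e1 + bc_of_complex b * bc_e2 \<longleftrightarrow> a = bc_comp1 x \<and> b = bc_comp2 x"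
  by (cases x) (auto simp: bc_idem_defs bicomplex_ops_def complex_eq_iff field_simps)

lemma bc_comp_hom:
  "bc_comp1 (x + y) = bc_comp1 x + bc_comp1 y" "bc_comp1 (x * y) = bc_comp1 x * bc_comp1 y"
  "bc_comp2 (x + y) = bc_comp2 x + bc_comp2 y" "bc_comp2 (x * y) = bc_comp2 x * bc_comp2 y"
  by (auto simp: bc_comp1_def bc_comp2_def bicomplex_ops_def algebra_simps)

abbreviation mat_comp1 :: "bicomplex mat \<Rightarrow> complex mat" where
  "mat_comp1 \<equiv> map_mat bc_comp1"

abbreviation mat_comp2 :: "bicomplex mat \<Rightarrow> complex mat" where
  "mat_comp2 \<equiv> map_mat bc_comp2"

abbreviation vec_comp1 :: "bicomplex vec \<Rightarrow> complex vec" where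
  "vec_comp1 \<equiv> map_vec bc_comp1"

abbreviation vec_comp2 :: "bicomplex vec \<Rightarrow> complex vec" where
  "vec_comp2 \<equiv> map_vec bc_comp2"

lemma mat_idempotent_decomp_iff:
  assumes "M \<in> carrier_mat m n" "P \<in> carrier_mat m n" "Q \<in> carrier_mat m n"
  shows "M = bc_e1 \<cdot>\<^sub>m map_mat bc_of_complex P + bc_e2 \<cdot>\<^sub>m map_mat bc_of_complex Q
    \<longleftrightarrow> P = mat_comp1 M \<and> Q = mat_comp2 M"
proof -
  have entry: "x = bc_e1 * bc_of_complex a + bc_e2 * bc_of_complex b
      \<longleftrightarrow> a = bc_comp1 x \<and> b = bc_comp2 x" for x a b
    using bc_idempotent_decomp_iff[of x a b] by (simp add: mult.commute)
  show ?thesis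
    using assms by (auto simp: mat_eq_iff entry)
qed

lemma vec_idempotent_decomp_iff:
  assumes "v \<in> carrier_vec m" "p \<in> carrier_vec m" "q \<in> carrier_vec m"
  shows "v = bc_e1 \<cdot>\<^sub>v map_vec bc_of_complex p + bc_e2 \<cdot>\<^sub>v map_vec bc_of_complex q
    \<longleftrightarrow> p = vec_comp1 v \<and> q = vec_comp2 v"
proof -
  have entry: "x = bc_e1 * bc_of_complex a + bc_e2 * bc_of_complex b
      \<longleftrightarrow> a = bc_comp1 x \<and> b = bc_comp2 x" for x a b
    using bc_idempotent_decomp_iff[of x a b] by (simp add: mult.commute)
  show ?thesis
    using assms by (auto simp: vec_eq_iff entry)
qed


section \<open>Ranks and augmented matrices\<close>

text \<open>In \<^const>\<open>vec_space.rank\<close> the first argument is the dimension of the ambient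
  space of the columns, i.e. the number of rows.\<close>

definition mat_rank :: "complex mat \<Rightarrow> nat" where
  "mat_rank M = vec_space.rank (dim_row M) M"

definition modified_rank :: "bicomplex mat \<Rightarrow> nat" where
  "modified_rank M = mat_rank (mat_comp1 M) + mat_rank (mat_comp2 M)"

definition augment :: "'a mat \<Rightarrow> 'a vec \<Rightarrow> 'a mat" where
  "augment M v = mat (dim_row M) (dim_col M + 1)
     (\<lambda>(i, j). if j < dim_col M then M $$ (i, j) else v $ i)"

end

theory Submission
  imports Defs
begin

text \<open>A bicomplex system splits into two independent complex systems, because the two idempotent
  components are ring homomorphisms and determine each bicomplex number. Over a field, \<open>Mx = v\<close> is
  solvable iff \<open>v\<close> lies in the column space, and appending \<open>v\<close> leaves the rank unchanged in exactly
  that case. Since appending a column never lowers the rank, equality of the two rank sums forces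
  equality of both summands.\<close>

lemma augment_carrier:
  "M \<in> carrier_mat m n \<Longrightarrow> augment M v \<in> carrier_mat m (Suc n)"
  by (simp add: augment_def)

lemma set_cols_augment:
  assumes "M \<in> carrier_mat m n" "v \<in> carrier_vec m"
  shows "set (cols (augment M v)) = insert v (set (cols M))"
proof -
  have "cols (augment M v) = cols M @ [v]"
    by (rule nth_equalityI)
      (use assms in \<open>auto simp: augment_def nth_append less_Suc_eq intro!: eq_vecI\<close>)
  then show ?thesis by simp
qed

lemma map_mat_augment:
  assumes "M \<in> carrier_mat m n" "v \<in> carrier_vec m"
  shows "map_mat f (augment M v) = augment (map_mat f M) (map_vec f v)"
  by (rule eq_matI) (use assms in \<open>auto simp: augment_def\<close>)

context vec_space
begin

text \<open>\<open>rank\<close> is the dimension of the span of the columns, so it suffices that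
  both column sets span the same space.\<close>

lemma rank_augment_in_span:
  assumes "M \<in> carrier_mat n k" "v \<in> span (set (cols M))"
  shows "rank (augment M v) = rank M"
proof -
  have cols: "set (cols M) \<subseteq> carrier_vec n"
    using assms(1) cols_dim by blast
  have v: "v \<in> carrier_vec n"
    using assms(2) cols span_is_subset2 by blast
  have "span (insert v (set (cols M))) = span (set (cols M))"
  proof
    show "span (insert v (set (cols M))) \<subseteq> span (set (cols M))"
      using assms(2) cols in_own_span by (intro span_subsetI) auto
    show "span (set (cols M)) \<subseteq> span (insert v (set (cols M)))"
      by (rule span_is_monotone) blast
  qed
  then show ?thesis
    by (simp add: rank_def set_cols_augment[OF assms(1) v])
qed

text \<open>A maximal independent set \<open>S\<close> of columns of \<open>M\<close> has
  \<open>rank M\<close> elements. As \<open>v\<close> lies outside its span,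
  \<open>insert v S\<close> is an independent set of columns of the augmented matrix with one more
  element.\<close>

lemma rank_augment_not_in_span:
  assumes "M \<in> carrier_mat n k" "v \<in> carrier_vec n" "v \<notin> span (set (cols M))"
  shows "rank M < rank (augment M v)"
proof -
  have cols: "set (cols M) \<subseteq> carrier_vec n"
    using assms(1) cols_dim by blast
  \<comment> \<open>\<open>S\<close> arises by enlarging the independent set \<open>{}\<close>
    inside the finite set of columns.\<close>
  obtain S where S: "finite S" "maximal S (\<lambda>T. T \<subseteq> set (cols M) \<and> lin_indpt T)"
    using maximal_exists_superset[of "set (cols M)" "\<lambda>T. T \<subseteq> set (cols M) \<and> lin_indpt T" "{}"]
    by (auto simp: finite_lin_indpt2)
  then have sub: "S \<subseteq> set (cols M)" and li: "lin_indpt S"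
    by (auto simp: maximal_def)
  have notin: "v \<notin> span S"
    using assms(3) span_is_monotone[OF sub] by blast
  moreover have "S \<subseteq> carrier_vec n"
    using sub cols by blast
  ultimately have "v \<notin> S" "lin_indpt (insert v S)"
    using lin_dep_iff_in_span[of S v] li assms(2) span_mem by auto
  then have "card (insert v S) \<le> rank (augment M v)"
    using sub set_cols_augment[OF assms(1,2)]
    by (intro rank_ge_card_indpt[OF augment_carrier[OF assms(1)]]) auto
  then show ?thesis
    using rank_card_indpt[OF assms(1) S(2)] S(1) \<open>v \<notin> S\<close> by simp
qed

end

text \<open>Needed to split an equality of rank sums. Either \<open>v\<close> is in the column span
  and the rank stays, or it is not and the rank grows.\<close>

lemma mat_rank_augment_ge:
  assumes "M \<in> carrier_mat m n" "v \<in> carrier_vec m"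
  shows "mat_rank M \<le> mat_rank (augment M v)"
  using assms vec_space.rank_augment_in_span[OF assms(1), of v]
    vec_space.rank_augment_not_in_span[OF assms]
  by (cases "v \<in> LinearCombinations.module.span class_ring (module_vec TYPE(complex) m) (set (cols M))")
     (auto simp: mat_rank_def augment_def)

text \<open>The products \<open>M *\<^sub>v x\<close> are exactly the vectors of the column space,
  which turns solvability into span membership.\<close>

lemma rouche_capelli:
  assumes "M \<in> carrier_mat m n" "v \<in> carrier_vec m"
  shows "(\<exists>x \<in> carrier_vec n. M *\<^sub>v x = v) \<longleftrightarrow> mat_rank (augment M v) = mat_rank M"
proof -
  interpret vec_space "TYPE(complex)" m .
  have "(\<exists>x \<in> carrier_vec n. M *\<^sub>v x = v) \<longleftrightarrow> v \<in> span (set (cols M))"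
    using col_space_eq[OF assms(1)] assms by (auto simp: col_space_def)
  also have "\<dots> \<longleftrightarrow> rank (augment M v) = rank M"
    using rank_augment_in_span[OF assms(1)] rank_augment_not_in_span[OF assms] by fastforce
  finally show ?thesis
    using assms(1) augment_carrier[OF assms(1), of v] by (simp add: mat_rank_def)
qed

lemma bicomplex_eq_iff: "x = y \<longleftrightarrow> bc_comp1 x = bc_comp1 y \<and> bc_comp2 x = bc_comp2 y"
  using bc_idempotent_decomp_iff[of x] bc_idempotent_decomp_iff[of y] by metis

lemma bicomplex_with_comps: "\<exists>x. bc_comp1 x = a \<and> bc_comp2 x = b"
  using bc_idempotent_decomp_iff by metis

lemma bc_comp_sum:
  "bc_comp1 (\<Sum>i\<in>S. f i) = (\<Sum>i\<in>S. bc_comp1 (f i))"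
  "bc_comp2 (\<Sum>i\<in>S. f i) = (\<Sum>i\<in>S. bc_comp2 (f i))"
proof -
  \<comment> \<open>Covers the empty and the infinite index set, where the sum is 0 by
    convention.\<close>
  have "bc_comp1 0 = 0" "bc_comp2 0 = 0"
    by (simp_all add: bc_comp1_def bc_comp2_def zero_bicomplex_def)
  then show "bc_comp1 (\<Sum>i\<in>S. f i) = (\<Sum>i\<in>S. bc_comp1 (f i))"
    "bc_comp2 (\<Sum>i\<in>S. f i) = (\<Sum>i\<in>S. bc_comp2 (f i))"
    by (induction S rule: infinite_finite_induct) (simp_all add: bc_comp_hom)
qed

lemma comp_mult_mat_vec:
  assumes "A \<in> carrier_mat m n" "X \<in> carrier_vec n"
  shows "vec_comp1 (A *\<^sub>v X) = mat_comp1 A *\<^sub>v vec_comp1 X"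
    "vec_comp2 (A *\<^sub>v X) = mat_comp2 A *\<^sub>v vec_comp2 X"
  using assms by (auto simp: scalar_prod_def bc_comp_sum bc_comp_hom intro!: eq_vecI)

lemma bicomplex_vec_eq_iff:
  "v = w \<longleftrightarrow> vec_comp1 v = vec_comp1 w \<and> vec_comp2 v = vec_comp2 w"
  by (auto simp: vec_eq_iff bicomplex_eq_iff)

lemma bicomplex_vec_with_comps:
  assumes "p \<in> carrier_vec n" "q \<in> carrier_vec n"
  obtains X where "X \<in> carrier_vec n" "vec_comp1 X = p" "vec_comp2 X = q"
proof -
  have "\<forall>i. \<exists>x. bc_comp1 x = p $ i \<and> bc_comp2 x = q $ i"
    by (simp add: bicomplex_with_comps)
  \<comment> \<open>The choice runs over all indices; \<open>vec n f\<close> reads only those below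
    \<open>n\<close>.\<close>
  then obtain f where f: "\<And>i. bc_comp1 (f i) = p $ i" "\<And>i. bc_comp2 (f i) = q $ i"
    by (auto dest!: choice)
  show ?thesis
    by (rule that[of "vec n f"]) (use assms f in \<open>auto intro!: eq_vecI\<close>)
qed

text \<open>A solution projects to both component systems; conversely, two complex solutions, chosen
  independently, are the components of one bicomplex vector.\<close>

lemma bicomplex_system_solvable_iff:
  assumes A: "A \<in> carrier_mat m n"
  shows "(\<exists>X \<in> carrier_vec n. A *\<^sub>v X = B) \<longleftrightarrow>
    (\<exists>p \<in> carrier_vec n. mat_comp1 A *\<^sub>v p = vec_comp1 B) \<and>
    (\<exists>q \<in> carrier_vec n. mat_comp2 A *\<^sub>v q = vec_comp2 B)"
  (is "?L \<longleftrightarrow> ?R")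
proof
  assume ?L
  then obtain X where "X \<in> carrier_vec n" "A *\<^sub>v X = B" by blast
  then show ?R
    using comp_mult_mat_vec[OF A, of X] by (metis map_carrier_vec)
next
  assume ?R
  then obtain p q where p: "p \<in> carrier_vec n" "mat_comp1 A *\<^sub>v p = vec_comp1 B"
    and q: "q \<in> carrier_vec n" "mat_comp2 A *\<^sub>v q = vec_comp2 B" by blast
  obtain X where X: "X \<in> carrier_vec n" "vec_comp1 X = p" "vec_comp2 X = q"
    using bicomplex_vec_with_comps[OF p(1) q(1)] .
  then have "A *\<^sub>v X = B"
    using p q comp_mult_mat_vec[OF A X(1)] by (subst bicomplex_vec_eq_iff) simp
  with X(1) show ?L by blast
qed

theorem corollary2p13:
  fixes A :: "bicomplex mat" and B :: "bicomplex vec" and m n :: nat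
  assumes "A \<in> carrier_mat m n" and "B \<in> carrier_vec m"
  shows "((\<exists>X \<in> carrier_vec n. A *\<^sub>v X = B) \<longleftrightarrow>
            (mat_rank (augment (mat_comp1 A) (vec_comp1 B)) = mat_rank (mat_comp1 A) \<and>
             mat_rank (augment (mat_comp2 A) (vec_comp2 B)) = mat_rank (mat_comp2 A)))
       \<and> ((mat_rank (augment (mat_comp1 A) (vec_comp1 B)) = mat_rank (mat_comp1 A) \<and>
             mat_rank (augment (mat_comp2 A) (vec_comp2 B)) = mat_rank (mat_comp2 A)) \<longleftrightarrow>
            modified_rank (augment A B) = modified_rank A)"
proof -
  have c1: "mat_comp1 A \<in> carrier_mat m n" "vec_comp1 B \<in> carrier_vec m"
    and c2: "mat_comp2 A \<in> carrier_mat m n" "vec_comp2 B \<in> carrier_vec m"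
    using assms by auto
  show ?thesis
    unfolding bicomplex_system_solvable_iff[OF assms(1)] rouche_capelli[OF c1]
      rouche_capelli[OF c2] modified_rank_def map_mat_augment[OF assms]
    \<comment> \<open>What remains is arithmetic: if \<open>a \<le> a'\<close>,
      \<open>b \<le> b'\<close> and \<open>a' + b' = a + b\<close>, then \<open>a' = a\<close> and
      \<open>b' = b\<close>.\<close>
    using mat_rank_augment_ge[OF c1] mat_rank_augment_ge[OF c2] by auto
qed

end
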